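(* Let $(X,0)\subsetneq(\mathbb{R}^n,0)$ be a closed definable germ satisfying $\mathrm{Aff}(C_0X)=\mathbb{R}^k\times\{0\}^{n-k}$ for some $1\leqslant k<n$. If $\theta(X,0)<2$, then $0\in\overline{M_X}$.
   Context: "Definable" means definable in a fixed polynomially bounded o-minimal structure on the field $\mathbb{R}$. The germ is represented by a closed definable set $X\subset\mathbb{R}^n$ with $0\in X$. $m(p)=\{x\in X\mid \|p-x\|=d(p,X)\}$ (Euclidean distance), and the medial axis is $M_X=\{p\in\mathbb{R}^n\mid \# m(p)>1\}$. The Peano tangent cone is $C_0X=\{w\mid \exists\,X\ni x_\nu\to 0,\ \exists\,\lambda_\nu>0:\ \lambda_\nu x_\nu\to w\}$; $\mathrm{Aff}$ denotes the affine hull. Writing points of $\mathbb{R}^n$ as $(x,y)\in\mathbb{R}^k\times\mathbb{R}^{n-k}$, the general curvature is $\theta(X,0)=\sup\{\theta>0\mid (X,0)\subset\{\|y\|\leqslant c\|x\|^\theta\}\text{ for some constant } c>0\}$, where inclusion of germs means that the intersection of $X$ with some neighbourhood of $0$ is contained in the right-hand set. *)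

theory Defs
  imports "HOL-Analysis.Analysis"
begin

text \<open>
  A point of \<open>\<real>\<^sup>n\<close> is encoded as a real list of length \<open>n\<close>, and \<open>S n\<close> is the collection of
  definable subsets of \<open>\<real>\<^sup>n\<close>. Definability is with real parameters: \<open>o_minimal\<close> puts all
  singletons into \<open>S 1\<close>. On the real line, \<^const>\<open>is_interval\<close> means order-convex, so
  points, rays and the whole line are intervals.
\<close>

locale o_minimal_structure_on_real_field =
  fixes S :: "nat \<Rightarrow> real list set set"
  assumes subset_space: "\<And>A n. A \<in> S n \<Longrightarrow> A \<subseteq> {xs. length xs = n}"
    and empty: "\<And>n. {} \<in> S n"
    and union: "\<And>A B n. A \<in> S n \<Longrightarrow> B \<in> S n \<Longrightarrow> A \<union> B \<in> S n"
    and complement: "\<And>A n. A \<in> S n \<Longrightarrow> {xs. length xs = n} - A \<in> S n"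
    and times_left: "\<And>A n. A \<in> S n \<Longrightarrow> {x # xs | x xs. xs \<in> A} \<in> S (Suc n)"
    and times_right: "\<And>A n. A \<in> S n \<Longrightarrow> {xs @ [x] | xs x. xs \<in> A} \<in> S (Suc n)"
    and diagonal: "\<And>i j n. i < n \<Longrightarrow> j < n \<Longrightarrow> {xs. length xs = n \<and> xs ! i = xs ! j} \<in> S n"
    and projection: "\<And>A n. A \<in> S (Suc n) \<Longrightarrow> butlast ` A \<in> S n"
    and order: "{[x, y] | x y. x < y} \<in> S 2"
    and addition: "{[x, y, x + y] | x y. True} \<in> S 3"
    and multiplication: "{[x, y, x * y] | x y. True} \<in> S 3"
    and o_minimal:
      "\<And>B. (\<lambda>x. [x]) ` B \<in> S 1 \<longleftrightarrow> (\<exists>\<I>. finite \<I> \<and> (\<forall>I\<in>\<I>. is_interval I) \<and> B = \<Union>\<I>)"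

locale polynomially_bounded_o_minimal_structure = o_minimal_structure_on_real_field +
  assumes polynomially_bounded:
    "\<And>f. {[x, f x] | x. True} \<in> S 2 \<Longrightarrow> \<exists>N::nat. \<forall>\<^sub>F x in at_top. \<bar>f x\<bar> \<le> x ^ N"

text \<open>
  Reading off coordinates requires an enumeration of the standard basis. Structures are closed
  under permutations of the coordinates (by \<open>diagonal\<close>, the products and \<open>projection\<close>), so the
  choice of the enumeration is immaterial.
\<close>

definition definable :: "(nat \<Rightarrow> real list set set) \<Rightarrow> 'a::euclidean_space set \<Rightarrow> bool" where
  "definable S X \<longleftrightarrow>
    (\<exists>bs. distinct bs \<and> set bs = Basis \<and> (\<lambda>x. map (\<lambda>b. x \<bullet> b) bs) ` X \<in> S DIM('a))"

definition nearest_points :: "'a::euclidean_space set \<Rightarrow> 'a \<Rightarrow> 'a set" where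
  "nearest_points X p = {x \<in> X. norm (p - x) = infdist p X}"

definition medial_axis :: "'a::euclidean_space set \<Rightarrow> 'a set" where
  "medial_axis X = {p. \<exists>a\<in>nearest_points X p. \<exists>b\<in>nearest_points X p. a \<noteq> b}"

definition tangent_cone :: "'a::euclidean_space set \<Rightarrow> 'a set" where
  "tangent_cone X = {w. \<exists>(x :: nat \<Rightarrow> 'a) (l :: nat \<Rightarrow> real).
     (\<forall>i. x i \<in> X) \<and> x \<longlonglongrightarrow> 0 \<and> (\<forall>i. l i > 0) \<and> (\<lambda>i. l i *\<^sub>R x i) \<longlonglongrightarrow> w}"

text \<open>
  The supremum is taken in the extended reals: it is \<open>\<infinity>\<close>, for instance, if the germ is contained
  in \<open>{(x, y). y = 0}\<close>. The set of admissible exponents contains 1 as soon as the tangent cone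
  is contained in \<open>{(x, y). y = 0}\<close>, so the value \<open>-\<infinity>\<close> of the empty supremum plays no role there.
\<close>

definition general_curvature :: "('a::euclidean_space \<times> 'b::euclidean_space) set \<Rightarrow> ereal" where
  "general_curvature X = Sup {ereal \<theta> | \<theta>. \<theta> > 0 \<and>
     (\<exists>c>0. \<exists>U. open U \<and> 0 \<in> U \<and> X \<inter> U \<subseteq> {(x, y). norm y \<le> c * norm x powr \<theta>})}"

end

theory Submission
  imports Defs
begin

text \<open>
  If \<open>M\<^sub>X\<close> misses a ball around \<open>0\<close>, the nearest-point projection is single-valued, hence
  continuous, there. Brouwer's theorem then shows that the segment from \<open>a = m(p)\<close> to \<open>p\<close> can be
  prolonged by a definite length \<open>r\<close> without changing the nearest point, so \<open>X\<close> is touched at \<open>a\<close>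
  by an exterior ball of radius at least \<open>r\<close>. For \<open>b \<in> X\<close> and \<open>p = t b\<close>, the points \<open>0\<close> and \<open>b\<close> both
  lie outside this ball, which bounds the distance of \<open>t b\<close> to \<open>X\<close> by \<open>t \<parallel>b\<parallel>\<^sup>2 / r\<close>; dividing by \<open>t\<close> and letting \<open>t \<rightarrow> 0\<close> yields a tangent vector at
  distance at most \<open>\<parallel>b\<parallel>\<^sup>2 / r\<close> from \<open>b\<close>. Hence \<open>\<parallel>y\<parallel> = O(\<parallel>x\<parallel>\<^sup>2)\<close> on \<open>X\<close>, that is \<open>\<theta>(X,0) \<ge> 2\<close>.
\<close>

section \<open>Nearest points off the medial axis\<close>

lemma nearest_points_nonempty:
  fixes X :: "'a::euclidean_space set"
  assumes "closed X" "X \<noteq> {}"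
  obtains a where "a \<in> nearest_points X p"
proof -
  obtain a where "a \<in> X" "infdist p X = dist p a"
    using infdist_attains_inf[OF assms] by blast
  then show thesis
    using that by (auto simp: nearest_points_def dist_norm)
qed

lemma nearest_points_norm_le:
  assumes "a \<in> nearest_points X p" "x \<in> X"
  shows "norm (p - a) \<le> norm (p - x)"
  using assms infdist_le[of x X p] by (auto simp: nearest_points_def dist_norm)

lemma nearest_points_unique:
  assumes "p \<notin> medial_axis X" "a \<in> nearest_points X p" "b \<in> nearest_points X p"
  shows "a = b"
  using assms by (auto simp: medial_axis_def)

text \<open>The distance to \<open>X\<close> is 1-Lipschitz, so it cannot drop by more than the
  length travelled from \<open>q\<close> towards \<open>a\<close>.\<close>

lemma nearest_points_towards:
  fixes X :: "'a::euclidean_space set"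
  assumes "a \<in> nearest_points X q" "0 \<le> t" "t \<le> 1"
  shows "a \<in> nearest_points X (a + t *\<^sub>R (q - a))"
proof -
  let ?p = "a + t *\<^sub>R (q - a)"
  have a: "a \<in> X" "norm (q - a) = infdist q X"
    using assms(1) by (auto simp: nearest_points_def)
  have "q - ?p = (1 - t) *\<^sub>R (q - a)"
    by (simp add: algebra_simps)
  then have "dist q ?p = (1 - t) * norm (q - a)"
    using assms by (simp add: dist_norm)
  then have "norm (q - a) \<le> infdist ?p X + (1 - t) * norm (q - a)"
    using infdist_triangle[of q X ?p] a by simp
  then have "t * norm (q - a) \<le> infdist ?p X"
    by (simp add: algebra_simps)
  moreover have "norm (?p - a) = t * norm (q - a)"
    using assms by simp
  moreover have "infdist ?p X \<le> norm (?p - a)"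
    using infdist_le[OF a(1), of ?p] by (simp add: dist_norm)
  ultimately have "norm (?p - a) = infdist ?p X"
    by linarith
  then show ?thesis
    using a by (simp add: nearest_points_def)
qed

text \<open>A map into a compact set with closed graph is continuous. Comparison with one fixed
  value \<open>m k\<close> bounds all values of \<open>m\<close> on \<open>K\<close>.\<close>

lemma continuous_nearest_point:
  fixes X :: "'a::euclidean_space set"
  assumes "closed X" "compact K" "K \<inter> medial_axis X = {}"
    and m: "\<And>p. p \<in> K \<Longrightarrow> m p \<in> nearest_points X p"
  shows "continuous_on K m"
proof (cases "K = {}")
  case False
  then obtain k where k: "k \<in> K" by blast
  obtain B where B: "\<And>x. x \<in> K \<Longrightarrow> norm x \<le> B"
    using compact_imp_bounded[OF assms(2)] by (auto simp: bounded_iff)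
  have mX: "m k \<in> X" using m[OF k] by (simp add: nearest_points_def)
  have "norm (m p) \<le> B + (B + norm (m k))" if p: "p \<in> K" for p
  proof -
    have "norm (p - m p) \<le> norm (p - m k)"
      using nearest_points_norm_le[OF m[OF p] mX] .
    also have "\<dots> \<le> B + norm (m k)"
      using norm_triangle_ineq4[of p "m k"] B[OF p] by linarith
    finally show ?thesis
      using norm_triangle_ineq4[of p "p - m p"] B[OF p] by simp
  qed
  then have sub: "m ` K \<subseteq> cball 0 (B + (B + norm (m k)))"
    by auto
  \<comment> \<open>Uniqueness of the nearest point gives the inclusion from right to left.\<close>
  have "(\<lambda>x. (x, m x)) ` K =
      (K \<times> X) \<inter> {z. norm (fst z - snd z) = infdist (fst z) X}"
    using m nearest_points_unique[of _ X] assms(3)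
    by (fastforce simp: nearest_points_def)
  moreover have "closed {z. norm (fst z - snd z) = infdist (fst z) X}"
    by (intro closed_Collect_eq continuous_intros)
  ultimately have "closed ((\<lambda>x. (x, m x)) ` K)"
    using assms by (simp add: closed_Int closed_Times compact_imp_closed)
  then show ?thesis
    using continuous_from_closed_graph[OF compact_cball] sub by blast
qed simp

section \<open>Prolongation and exterior balls\<close>

text \<open>A fixed point \<open>q\<close> of the map \<open>f\<close> has \<open>p\<close> between
  \<open>m q\<close> and \<open>q\<close>. Hence \<open>m q\<close> is also nearest to
  \<open>p\<close>, and uniqueness at \<open>p\<close> makes it \<open>a\<close>.\<close>

lemma nearest_points_prolong:
  fixes X :: "'a::euclidean_space set"
  assumes "closed X" "cball p r \<inter> medial_axis X = {}" "0 < r"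
    and p: "p \<notin> X" "a \<in> nearest_points X p"
  shows "a \<in> nearest_points X (p + (r / norm (p - a)) *\<^sub>R (p - a))"
proof -
  have aX: "a \<in> X" using p(2) by (simp add: nearest_points_def)
  then have "\<forall>q. \<exists>b. b \<in> nearest_points X q"
    using nearest_points_nonempty[OF assms(1)] by blast
  then obtain m where m: "\<And>q. m q \<in> nearest_points X q"
    by metis
  have mX: "m q \<in> X" for q
    using m[of q] by (simp add: nearest_points_def)
  then have ne: "p - m q \<noteq> 0" for q
    using p(1) by (metis eq_iff_diff_eq_0)
  \<comment> \<open>\<open>f q\<close> lies at distance \<open>r\<close> from \<open>p\<close>, on
    the side opposite to \<open>m q\<close>.\<close>
  define f where "f q = p + (r / norm (p - m q)) *\<^sub>R (p - m q)" for q
  have "continuous_on (cball p r) m"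
    by (rule continuous_nearest_point[OF assms(1) compact_cball assms(2) m])
  then have "continuous_on (cball p r) f"
    unfolding f_def using ne by (intro continuous_intros) auto
  moreover have "f ` cball p r \<subseteq> cball p r"
    using ne \<open>0 < r\<close> by (auto simp: f_def dist_norm)
  ultimately obtain q where q: "q \<in> cball p r" "f q = q"
    using brouwer[of "cball p r" f] \<open>0 < r\<close> by (metis compact_cball convex_cball cball_eq_empty
        image_subset_iff_funcset less_imp_le not_less)
  define d where "d = norm (p - m q)"
  have d: "d > 0" using ne by (simp add: d_def)
  \<comment> \<open>At the fixed point, \<open>p\<close> cuts the segment from \<open>m q\<close> to
    \<open>q\<close> into lengths \<open>d\<close> and \<open>r\<close>.\<close>
  define t where "t = d / (d + r)"
  have "q - m q = ((d + r) / d) *\<^sub>R (p - m q)"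
    using q(2) d by (simp add: f_def d_def[symmetric] algebra_simps add_divide_distrib)
  then have "m q + t *\<^sub>R (q - m q) = p"
    using d \<open>0 < r\<close> by (simp add: t_def)
  then have "m q \<in> nearest_points X p"
    using nearest_points_towards[OF m, of t q] d \<open>0 < r\<close> by (simp add: t_def)
  moreover have "p \<notin> medial_axis X"
    using assms(2,3) by force
  ultimately have "m q = a"
    using nearest_points_unique p(2) by blast
  then show ?thesis
    using m[of q] q(2) by (simp add: f_def)
qed

text \<open>This expands the square of \<open>norm (q - a) \<le> norm (q - x)\<close> for the
  prolonged point \<open>q\<close>. The factor \<open>norm (p - a)\<close> on the right avoids a
  division, so that \<open>p = a\<close> is allowed.\<close>

lemma exterior_ball_inner_le:
  fixes X :: "'a::euclidean_space set"
  assumes "closed X" "cball p r \<inter> medial_axis X = {}" "0 < r"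
    and p: "a \<in> nearest_points X p" and "x \<in> X"
  shows "2 * r * inner (x - a) (p - a) \<le> norm (p - a) * (norm (x - a))\<^sup>2"
proof (cases "p \<in> X")
  case True
  then have "norm (p - a) \<le> norm (p - p)"
    using nearest_points_norm_le[OF p] by blast
  then show ?thesis by simp
next
  case False
  define d where "d = norm (p - a)"
  have "d > 0"
  proof -
    have "p \<noteq> a" using False p by (auto simp: nearest_points_def)
    then show ?thesis by (simp add: d_def)
  qed
  define q where "q = p + (r / d) *\<^sub>R (p - a)"
  define c where "c = 1 + r / d"
  have "0 < c" using \<open>0 < d\<close> \<open>0 < r\<close> by (simp add: c_def add_pos_pos)
  have qa: "q - a = c *\<^sub>R (p - a)"
    by (simp add: q_def c_def algebra_simps)
  have "a \<in> nearest_points X q"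
    unfolding q_def d_def by (rule nearest_points_prolong[OF assms(1-3) False p])
  then have "norm (q - a) \<le> norm (q - x)"
    using nearest_points_norm_le \<open>x \<in> X\<close> by blast
  then have "(norm (q - a))\<^sup>2 \<le> (norm ((q - a) - (x - a)))\<^sup>2"
    by simp
  also have "\<dots> = (norm (q - a))\<^sup>2 - 2 * inner (q - a) (x - a) + (norm (x - a))\<^sup>2"
    by (simp only: power2_norm_eq_inner) (simp add: inner_commute inner_diff algebra_simps)
  finally have *: "2 * c * inner (x - a) (p - a) \<le> (norm (x - a))\<^sup>2"
    by (simp add: qa inner_commute)
  have "2 * (c * d) * inner (x - a) (p - a) \<le> d * (norm (x - a))\<^sup>2"
    using mult_left_mono[OF *, of d] \<open>0 < d\<close> by (simp add: algebra_simps)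
  moreover have "c * d = d + r"
    using \<open>0 < d\<close> by (simp add: c_def algebra_simps)
  ultimately have **: "2 * (d + r) * inner (x - a) (p - a) \<le> d * (norm (x - a))\<^sup>2"
    by simp
  show ?thesis
  \<comment> \<open>Lowering \<open>d + r\<close> to \<open>r\<close> preserves the bound only for a
    nonnegative inner product.\<close>
  proof (cases "inner (x - a) (p - a) \<le> 0")
    case True
    then have "2 * r * inner (x - a) (p - a) \<le> 0"
      using \<open>0 < r\<close> by (simp add: mult_nonneg_nonpos)
    also have "0 \<le> d * (norm (x - a))\<^sup>2" using \<open>0 < d\<close> by simp
    finally show ?thesis by (simp add: d_def)
  next
    case False
    then have "2 * r * inner (x - a) (p - a) \<le> 2 * (d + r) * inner (x - a) (p - a)"
      using \<open>0 < d\<close> by (intro mult_right_mono) auto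
    with ** show ?thesis by (simp add: d_def)
  qed
qed

section \<open>Quadratic closeness to the tangent cone\<close>

lemma nearest_point_on_segment_le:
  fixes X :: "'a::euclidean_space set"
  assumes "closed X" "0 \<in> X" "b \<in> X" "norm b \<le> r" "0 < r"
    and "cball 0 (2 * r) \<inter> medial_axis X = {}"
    and t: "0 \<le> t" "t \<le> 1" and a: "a \<in> nearest_points X (t *\<^sub>R b)"
  shows "norm (t *\<^sub>R b - a) \<le> t * (norm b)\<^sup>2 / r"
proof -
  define d where "d = norm (t *\<^sub>R b - a)"
  have "norm (t *\<^sub>R b) \<le> r"
    using assms(4) t mult_left_le_one_le[of "norm b" t] by simp
  then have "cball (t *\<^sub>R b) r \<subseteq> cball 0 (2 * r)"
    by (simp add: cball_subset_cball_iff)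
  then have disj: "cball (t *\<^sub>R b) r \<inter> medial_axis X = {}"
    using assms(6) by blast
  note ext = exterior_ball_inner_le[OF assms(1) disj \<open>0 < r\<close> a]
  have "d \<le> norm (t *\<^sub>R b - 0)"
    unfolding d_def by (rule nearest_points_norm_le[OF a \<open>0 \<in> X\<close>])
  then have "d \<le> r" using \<open>norm (t *\<^sub>R b) \<le> r\<close> by simp
  let ?v = "t *\<^sub>R b - a"
  \<comment> \<open>\<open>?v\<close> is the convex combination of \<open>b - a\<close> and
    \<open>0 - a\<close> with weights \<open>t\<close> and \<open>1 - t\<close>, so the exterior
    ball estimate applies to both endpoints.\<close>
  have "d\<^sup>2 = t * inner (b - a) ?v + (1 - t) * inner (0 - a) ?v"
    unfolding d_def power2_norm_eq_inner by (simp add: inner_commute algebra_simps)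
  then have "2 * r * d\<^sup>2 = 2 * r * (t * inner (b - a) ?v + (1 - t) * inner (0 - a) ?v)"
    by (rule arg_cong)
  also have "\<dots> = t * (2 * r * inner (b - a) ?v) + (1 - t) * (2 * r * inner (0 - a) ?v)"
    by (simp only: distrib_left mult.left_commute mult.assoc)
  also have "\<dots> \<le> t * (d * (norm (b - a))\<^sup>2) + (1 - t) * (d * (norm (0 - a))\<^sup>2)"
    unfolding d_def using ext[OF \<open>b \<in> X\<close>] ext[OF \<open>0 \<in> X\<close>] t
    by (intro add_mono mult_left_mono) auto
  also have "\<dots> = d * (t * (norm (b - a))\<^sup>2 + (1 - t) * (norm (0 - a))\<^sup>2)"
    by (simp add: algebra_simps)
  \<comment> \<open>Stewart's identity for the point \<open>t *\<^sub>R b\<close> of the segment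
    from \<open>0\<close> to \<open>b\<close>.\<close>
  also have "t * (norm (b - a))\<^sup>2 + (1 - t) * (norm (0 - a))\<^sup>2 = d\<^sup>2 + t * (1 - t) * (norm b)\<^sup>2"
    unfolding d_def power2_norm_eq_inner by (simp add: inner_commute algebra_simps)
  finally have *: "d * (2 * r * d) \<le> d * (d\<^sup>2 + t * (1 - t) * (norm b)\<^sup>2)"
    by (simp add: power2_eq_square algebra_simps)
  show ?thesis
  proof (cases "d = 0")
    case True
    then show ?thesis using t \<open>0 < r\<close> by (simp add: d_def)
  next
    case False
    then have "d > 0" by (simp add: d_def)
    with * have "2 * r * d \<le> d\<^sup>2 + t * (1 - t) * (norm b)\<^sup>2"
      by simp
    \<comment> \<open>Half of \<open>2 * r * d\<close> absorbs the quadratic term;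
      \<open>d \<le> r\<close> holds because \<open>0\<close> competes with
      \<open>a\<close>.\<close>
    moreover have "d\<^sup>2 \<le> r * d"
      using \<open>d \<le> r\<close> \<open>d > 0\<close> by (simp add: power2_eq_square)
    moreover have "t * (1 - t) * (norm b)\<^sup>2 \<le> t * (norm b)\<^sup>2"
      using t by (intro mult_right_mono) (auto simp: mult_left_le)
    ultimately have "r * d \<le> t * (norm b)\<^sup>2"
      by linarith
    then show ?thesis
      using \<open>0 < r\<close> by (simp add: d_def field_simps)
  qed
qed

text \<open>Blowing up by \<open>s i\<close> turns the bound on the nearest points to
  \<open>b\<close> divided by \<open>s i\<close> into one independent of \<open>i\<close>;
  compactness then provides the limit \<open>w\<close>.\<close>

lemma tangent_vector_near_point:
  fixes X :: "'a::euclidean_space set"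
  assumes "closed X" "0 \<in> X" "b \<in> X" "norm b \<le> r" "0 < r"
    and "cball 0 (2 * r) \<inter> medial_axis X = {}"
  obtains w where "w \<in> tangent_cone X" "norm (b - w) \<le> (norm b)\<^sup>2 / r"
proof -
  define s where "s i = real (Suc i)" for i
  have s: "s i > 0" "s i \<ge> 1" for i by (auto simp: s_def)
  have "\<forall>i. \<exists>a. a \<in> nearest_points X (inverse (s i) *\<^sub>R b)"
    using nearest_points_nonempty[OF assms(1)] \<open>0 \<in> X\<close> by blast
  then obtain a where a: "\<And>i. a i \<in> nearest_points X (inverse (s i) *\<^sub>R b)"
    by metis
  define C where "C = (norm b)\<^sup>2 / r"
  have le: "norm (b - s i *\<^sub>R a i) \<le> C" for i
  proof -
    have "norm (inverse (s i) *\<^sub>R b - a i) \<le> inverse (s i) * (norm b)\<^sup>2 / r"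
      using s[of i] by (intro nearest_point_on_segment_le[OF assms _ _ a]) (auto simp: field_simps)
    then have "s i * norm (inverse (s i) *\<^sub>R b - a i) \<le> s i * (inverse (s i) * (norm b)\<^sup>2 / r)"
      using s(1)[of i] by (intro mult_left_mono) auto
    also have "\<dots> = C"
      using s(1)[of i] by (simp add: C_def)
    finally have "s i * norm (inverse (s i) *\<^sub>R b - a i) \<le> C" .
    moreover have "b - s i *\<^sub>R a i = s i *\<^sub>R (inverse (s i) *\<^sub>R b - a i)"
      using s[of i] by (simp add: algebra_simps)
    ultimately show ?thesis using s[of i] by simp
  qed
  then have mem: "s i *\<^sub>R a i \<in> cball b C" for i
    by (simp add: dist_norm)
  then obtain w \<rho> where w: "w \<in> cball b C" and \<rho>: "strict_mono \<rho>"
    and lim: "((\<lambda>i. s i *\<^sub>R a i) \<circ> \<rho>) \<longlonglongrightarrow> w"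
    using compact_cball[of b C] unfolding compact_def by meson
  have "(\<lambda>i. inverse (s i)) \<longlonglongrightarrow> 0"
    unfolding s_def by (rule LIMSEQ_inverse_real_of_nat)
  then have "(\<lambda>i. inverse (s (\<rho> i))) \<longlonglongrightarrow> 0"
    using LIMSEQ_subseq_LIMSEQ[OF _ \<rho>] by (simp add: o_def)
  \<comment> \<open>The rescaled points converge, so undoing the scaling sends the points themselves
    to \<open>0\<close>.\<close>
  from tendsto_scaleR[OF this lim] have "(\<lambda>i. a (\<rho> i)) \<longlonglongrightarrow> 0"
    using s(1) by (simp add: o_def less_imp_neq[symmetric])
  then have "w \<in> tangent_cone X"
    using lim a s(1) unfolding tangent_cone_def nearest_points_def o_def
    by (intro CollectI exI[of _ "\<lambda>i. a (\<rho> i)"] exI[of _ "\<lambda>i. s (\<rho> i)"]) auto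
  then show thesis
    using that w by (simp add: C_def dist_norm)
qed

theorem corollary5p6:
  fixes S :: "nat \<Rightarrow> real list set set"
    and X :: "((real ^ 'k) \<times> (real ^ 'l)) set"
  assumes "polynomially_bounded_o_minimal_structure S"
    and "closed X" and "definable S X" and "0 \<in> X"
    and "0 \<notin> interior X"
    and "affine hull (tangent_cone X) = UNIV \<times> {0}"
    and "general_curvature X < 2"
  shows "0 \<in> closure (medial_axis X)"
proof (rule ccontr)
  assume "0 \<notin> closure (medial_axis X)"
  then obtain e where e: "e > 0" "cball 0 e \<subseteq> - closure (medial_axis X)"
    using open_contains_cball[of "- closure (medial_axis X)"] by auto
  then have "cball 0 e \<inter> medial_axis X = {}"
    using closure_subset[of "medial_axis X"] by blast
  define r where "r = e / 2"
  have r: "0 < r" "cball 0 (2 * r) \<inter> medial_axis X = {}"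
    using \<open>e > 0\<close> \<open>cball 0 e \<inter> medial_axis X = {}\<close> by (simp_all add: r_def)
  have "norm y \<le> (2 / r) * norm x powr 2" if b: "(x, y) \<in> X" "norm (x, y) < r / 2" for x y
  proof -
    have "norm (x, y) \<le> r" using b(2) r(1) by linarith
    then obtain w where w: "w \<in> tangent_cone X" "norm ((x, y) - w) \<le> (norm (x, y))\<^sup>2 / r"
      using tangent_vector_near_point[OF \<open>closed X\<close> \<open>0 \<in> X\<close> b(1) _ r] by blast
    have "snd w = 0"
      using w(1) assms(6) hull_subset[of "tangent_cone X" affine] by auto
    then have "norm y \<le> norm ((x, y) - w)"
      using norm_snd_le[of "y - snd w" "x - fst w"] by (cases w) simp
    also note w(2)
    also have "(norm (x, y))\<^sup>2 = (norm x)\<^sup>2 + (norm y)\<^sup>2"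
      by (simp add: norm_Pair)
    finally have "r * norm y \<le> (norm x)\<^sup>2 + (norm y)\<^sup>2"
      using r(1) by (simp add: field_simps)
    moreover have "norm y \<le> r / 2"
      using norm_snd_le[of y x] b(2) by linarith
    then have "(norm y)\<^sup>2 \<le> r / 2 * norm y"
      unfolding power2_eq_square by (intro mult_right_mono) auto
    ultimately have "r / 2 * norm y \<le> (norm x)\<^sup>2"
      by linarith
    then show ?thesis
      using r(1) by (simp add: field_simps powr_numeral)
  qed
  then have "X \<inter> ball 0 (r / 2) \<subseteq> {(x, y). norm y \<le> (2 / r) * norm x powr 2}"
    by auto
  then have "ereal 2 \<le> general_curvature X"
    unfolding general_curvature_def using r(1)
    by (intro Sup_upper CollectI exI[of _ 2] conjI exI[of _ "2 / r"] exI[of _ "ball 0 (r / 2)"]) auto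
  then show False
    using assms(7) by simp
qed

end
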